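(* There is an absolute constant $C>0$ such that the following holds. For every integer $k\geq 1$, every $\rho\in(0,1]$, every $\varepsilon\in(0,1]$ and $\delta\in(0,1)$, and every reference distribution $\mathbf{q}$ on $[k]$, there exists a private-coin $\rho$-LDP protocol for $(k,\varepsilon,\delta)$-identity testing in which each player sends a single bit, using $n=C\frac{k^{3/2}}{\varepsilon^2\rho^2}\log\frac{1}{\delta}$ players.
   Context: Notation: $[k]=\{1,\dots,k\}$; $d_{TV}(\mathbf{p},\mathbf{q})=\frac12\sum_x|\mathbf{p}(x)-\mathbf{q}(x)|$. A channel $W$ from a finite set $\mathcal{X}$ to a message set $\mathcal{Y}$ is $\rho$-locally differentially private ($\rho$-LDP) if $W(y\mid x')\leq e^{\rho}W(y\mid x)$ for all $y,x,x'$. Setting: $n$ players, player $i$ holds $X_i$, with $X_1,\dots,X_n$ i.i.d. from an unknown distribution $\mathbf{p}$ on $[k]$. In a private-coin (non-interactive) protocol each player $i$ chooses a $\rho$-LDP channel $W_i$ (possibly depending on its own private randomness $U_i$, the $U_i$ being mutually independent and independent of the samples) and simultaneously sends the message $Y_i$ obtained by passing $X_i$ through $W_i$ to a referee, who knows the protocol but not the $U_i$ and applies a (possibly randomized) map to $(Y_1,\dots,Y_n)$ outputting accept or reject. One bit per player means $Y_i\in\{0,1\}$. The protocol solves $(k,\varepsilon,\delta)$-identity testing for the known reference $\mathbf{q}$ if it accepts with probability $>1-\delta$ when $\mathbf{p}=\mathbf{q}$ and rejects with probability $>1-\delta$ when $d_{TV}(\mathbf{p},\mathbf{q})>\varepsilon$.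 *)

theory Defs
  imports "HOL-Probability.Probability" "HOL-Probability.Product_PMF"
begin

definition distribution_on :: "nat \<Rightarrow> nat pmf \<Rightarrow> bool" where
  "distribution_on k p \<longleftrightarrow> set_pmf p \<subseteq> {1..k}"

definition tv_dist :: "nat \<Rightarrow> nat pmf \<Rightarrow> nat pmf \<Rightarrow> real" where
  "tv_dist k p q = (1 / 2) * (\<Sum>x\<in>{1..k}. \<bar>pmf p x - pmf q x\<bar>)"

definition LDP :: "'x set \<Rightarrow> real \<Rightarrow> ('x \<Rightarrow> 'y pmf) \<Rightarrow> bool" where
  "LDP A \<rho> W \<longleftrightarrow> (\<forall>y. \<forall>x\<in>A. \<forall>x'\<in>A. pmf (W x') y \<le> exp \<rho> * pmf (W x) y)"

text \<open>
  Player \<open>i\<close> draws \<open>u\<close> from \<open>coin i\<close> and passes its sample through the channel \<open>channel i u\<close>.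
  The referee is a randomized map of the messages alone; \<open>True\<close> means accept.
\<close>

record ('u, 'y) protocol =
  coin :: "nat \<Rightarrow> 'u pmf"
  channel :: "nat \<Rightarrow> 'u \<Rightarrow> nat \<Rightarrow> 'y pmf"
  referee :: "(nat \<Rightarrow> 'y) \<Rightarrow> bool pmf"

definition LDP_protocol :: "nat \<Rightarrow> nat \<Rightarrow> real \<Rightarrow> ('u, 'y) protocol \<Rightarrow> bool" where
  "LDP_protocol n k \<rho> P \<longleftrightarrow>
     (\<forall>i\<in>{1..n}. \<forall>u\<in>set_pmf (coin P i). LDP {1..k} \<rho> (channel P i u))"

text \<open>
  The players are \<open>{1..n}\<close>; the vectors produced by \<open>Pi_pmf\<close> carry the constant
  \<open>undefined\<close> at all other indices.
\<close>

definition messages :: "nat \<Rightarrow> ('u, 'y) protocol \<Rightarrow> nat pmf \<Rightarrow> (nat \<Rightarrow> 'y) pmf" where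
  "messages n P p =
     bind_pmf (Pi_pmf {1..n} undefined (coin P)) (\<lambda>us.
     bind_pmf (Pi_pmf {1..n} undefined (\<lambda>_. p)) (\<lambda>xs.
     Pi_pmf {1..n} undefined (\<lambda>i. channel P i (us i) (xs i))))"

definition verdict :: "nat \<Rightarrow> ('u, 'y) protocol \<Rightarrow> nat pmf \<Rightarrow> bool pmf" where
  "verdict n P p = bind_pmf (messages n P p) (referee P)"

definition solves_identity_testing ::
  "nat \<Rightarrow> ('u, 'y) protocol \<Rightarrow> nat \<Rightarrow> real \<Rightarrow> real \<Rightarrow> nat pmf \<Rightarrow> bool" where
  "solves_identity_testing n P k \<epsilon> \<delta> q \<longleftrightarrow>
     pmf (verdict n P q) True > 1 - \<delta> \<and>
     (\<forall>p. distribution_on k p \<and> tv_dist k p q > \<epsilon> \<longrightarrow> pmf (verdict n P p) False > 1 - \<delta>)"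

end

theory Submission
  imports Defs
begin

text \<open>
  Let \<open>K = 2 ^ e\<close> be a power of two in \<open>[k, 2k]\<close>. Each player is assigned a row \<open>j\<close> of the Hadamard matrix
  of order \<open>K\<close> and sends the sign of its sample in that row through randomized response of bias
  \<open>\<alpha> = \<rho> / 4\<close>. By Parseval, the mean bits under \<open>p\<close> and under \<open>q\<close> differ by a vector \<open>\<Delta>\<close> with
  \<open>\<Sum>j<K. (\<Delta> j)\<^sup>2 = \<alpha>\<^sup>2 * K * (\<Sum>x. (p x - q x)\<^sup>2)\<close>, which Cauchy-Schwarz bounds below by \<open>4 * \<alpha>\<^sup>2 * \<epsilon>\<^sup>2\<close>.
  Two independent samples of \<open>m\<close> bits per row give an unbiased estimate of \<open>m\<^sup>2 * (\<Sum>j<K. (\<Delta> j)\<^sup>2)\<close>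
  with variance at most \<open>K * m\<^sup>2 + 2 * m ^ 3 * (\<Sum>j<K. (\<Delta> j)\<^sup>2)\<close>, so by Chebyshev \<open>m\<close> of order
  \<open>sqrt K / (\<rho>\<^sup>2 * \<epsilon>\<^sup>2)\<close> suffices for error \<open>1 / 16\<close>; this uses \<open>2 * m * K\<close> players. A majority vote over
  about \<open>log 2 (1 / \<delta>)\<close> rounds reduces the error to \<open>\<delta>\<close>. For \<open>\<delta> > 1 / 2\<close>, where the prescribed
  number of players may be too small for even one round, a fair coin is good enough.
\<close>

section \<open>Independence, variance and majority votes\<close>

text \<open>Each \<open>f c\<close> factors through the restriction to \<open>S c\<close>, and
  restrictions of a product distribution to disjoint blocks are independent. Countability of
  \<open>'b\<close> makes the finite product sigma-algebra on \<open>S c\<close> discrete, so every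
  \<open>f c\<close> is measurable.\<close>

lemma indep_vars_Pi_pmf_disjoint:
  fixes p :: "'i \<Rightarrow> 'b::countable pmf" and f :: "'c \<Rightarrow> ('i \<Rightarrow> 'b) \<Rightarrow> real"
  assumes A: "finite A"
    and S: "\<And>c. c \<in> L \<Longrightarrow> S c \<subseteq> A" "disjoint_family_on S L"
    and f: "\<And>c \<omega> \<omega>'. c \<in> L \<Longrightarrow> (\<And>i. i \<in> S c \<Longrightarrow> \<omega> i = \<omega>' i) \<Longrightarrow> f c \<omega> = f c \<omega>'"
  shows "prob_space.indep_vars (measure_pmf (Pi_pmf A d p)) (\<lambda>_. borel) f L"
proof -
  let ?M = "measure_pmf (Pi_pmf A d p)"
  have "prob_space.indep_vars ?M (\<lambda>c. PiM (S c) (\<lambda>_. count_space UNIV))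
          (\<lambda>c \<omega>. restrict (\<lambda>i. \<omega> i) (S c)) L"
    using prob_space.indep_vars_restrict[OF measure_pmf.prob_space_axioms
        indep_vars_Pi_pmf[OF A] S, of d p] by simp
  moreover have "f c \<in> borel_measurable (PiM (S c) (\<lambda>_. count_space UNIV))" if "c \<in> L" for c
    using finite_subset[OF S(1)[OF that] A] by (subst count_space_PiM_finite) auto
  ultimately have "prob_space.indep_vars ?M (\<lambda>_. borel)
                     (\<lambda>c \<omega>. f c (restrict (\<lambda>i. \<omega> i) (S c))) L"
    by (rule prob_space.indep_vars_compose2[OF measure_pmf.prob_space_axioms])
  also have "?this \<longleftrightarrow> ?thesis"
    by (intro prob_space.indep_vars_cong[OF measure_pmf.prob_space_axioms] refl ext f) auto
  finally show ?thesis .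
qed

text \<open>Induction on \<open>I\<close>: the new summand is independent of the sum of the others,
  so the expectation of the cross term factors. Square integrability of the partial sums is carried
  along because \<open>variance_eq\<close> needs it.\<close>

lemma (in prob_space) variance_sum_indep:
  fixes X :: "'i \<Rightarrow> 'a \<Rightarrow> real"
  assumes "finite I" "indep_vars (\<lambda>_. borel) X I"
    and "\<And>i. i \<in> I \<Longrightarrow> integrable M (X i)" "\<And>i. i \<in> I \<Longrightarrow> integrable M (\<lambda>\<omega>. (X i \<omega>)\<^sup>2)"
  shows "integrable M (\<lambda>\<omega>. (\<Sum>i\<in>I. X i \<omega>)\<^sup>2)"
    and "variance (\<lambda>\<omega>. \<Sum>i\<in>I. X i \<omega>) = (\<Sum>i\<in>I. variance (X i))"
proof -
  have "integrable M (\<lambda>\<omega>. (\<Sum>i\<in>I. X i \<omega>)\<^sup>2) \<and>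
        variance (\<lambda>\<omega>. \<Sum>i\<in>I. X i \<omega>) = (\<Sum>i\<in>I. variance (X i))"
    using assms
  proof (induction I rule: finite_induct)
    case (insert i I)
    let ?S = "\<lambda>\<omega>. \<Sum>i\<in>I. X i \<omega>"
    have IH: "integrable M (\<lambda>\<omega>. (?S \<omega>)\<^sup>2)" "variance ?S = (\<Sum>i\<in>I. variance (X i))"
      using insert by (auto intro: indep_vars_subset)
    have S: "integrable M ?S" and X: "integrable M (X i)" "integrable M (\<lambda>\<omega>. (X i \<omega>)\<^sup>2)"
      using insert.prems by auto
    have ind: "indep_var borel (X i) borel ?S"
      using insert by (intro indep_vars_sum) auto
    note XS = indep_var_integrable[OF ind X(1) S] indep_var_lebesgue_integral[OF ind X(1) S]
    have sq: "(\<lambda>\<omega>. (X i \<omega> + ?S \<omega>)\<^sup>2) = (\<lambda>\<omega>. (X i \<omega>)\<^sup>2 + (?S \<omega>)\<^sup>2 + 2 * (X i \<omega> * ?S \<omega>))"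
      by (auto simp: power2_eq_square algebra_simps)
    have int: "integrable M (\<lambda>\<omega>. (X i \<omega> + ?S \<omega>)\<^sup>2)"
      unfolding sq by (intro Bochner_Integration.integrable_add integrable_mult_right X IH XS)
    have "variance (\<lambda>\<omega>. X i \<omega> + ?S \<omega>) =
            expectation (\<lambda>\<omega>. (X i \<omega> + ?S \<omega>)\<^sup>2) - (expectation (\<lambda>\<omega>. X i \<omega> + ?S \<omega>))\<^sup>2"
      using S X int by (intro variance_eq) auto
    also have "\<dots> = expectation (\<lambda>\<omega>. (X i \<omega> + ?S \<omega>)\<^sup>2) - (expectation (X i) + expectation ?S)\<^sup>2"
      by (simp only: Bochner_Integration.integral_add[OF X(1) S])
    also have "expectation (\<lambda>\<omega>. (X i \<omega> + ?S \<omega>)\<^sup>2) = expectation (\<lambda>\<omega>. (X i \<omega>)\<^sup>2)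
                 + expectation (\<lambda>\<omega>. (?S \<omega>)\<^sup>2) + 2 * (expectation (X i) * expectation ?S)"
      unfolding sq using X IH XS
      by (simp only: Bochner_Integration.integral_add Bochner_Integration.integrable_add
            integrable_mult_right integral_mult_right_zero)
    also have "\<dots> - (expectation (X i) + expectation ?S)\<^sup>2 = variance (X i) + variance ?S"
      using S X IH by (subst (1 2) variance_eq) (auto simp: power2_eq_square algebra_simps)
    also note IH(2)
    finally have var: "variance (\<lambda>\<omega>. X i \<omega> + ?S \<omega>) = variance (X i) + (\<Sum>i\<in>I. variance (X i))" .
    have ins: "(\<Sum>i\<in>insert i I. f i) = f i + (\<Sum>i\<in>I. f i)" for f :: "'i \<Rightarrow> real"
      using insert.hyps by simp
    show ?case
      unfolding ins by (intro conjI int var)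
  qed simp
  thus "integrable M (\<lambda>\<omega>. (\<Sum>i\<in>I. X i \<omega>)\<^sup>2)"
    "variance (\<lambda>\<omega>. \<Sum>i\<in>I. X i \<omega>) = (\<Sum>i\<in>I. variance (X i))" by auto
qed

text \<open>The squares are independent too, so the second moment of the product is a product of
  second moments, each at most \<open>v + a\<^sup>2\<close>; the term \<open>a ^ 4\<close> cancels
  against the squared mean.\<close>

lemma (in prob_space) variance_mult_indep_le:
  fixes X Y :: "'a \<Rightarrow> real"
  assumes ind: "indep_var borel X borel Y"
    and int: "integrable M X" "integrable M Y" "integrable M (\<lambda>\<omega>. (X \<omega>)\<^sup>2)" "integrable M (\<lambda>\<omega>. (Y \<omega>)\<^sup>2)"
    and ex: "expectation X = a" "expectation Y = a"
    and var: "variance X \<le> v" "variance Y \<le> v"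
  shows "expectation (\<lambda>\<omega>. X \<omega> * Y \<omega>) = a\<^sup>2"
    and "variance (\<lambda>\<omega>. X \<omega> * Y \<omega>) \<le> v\<^sup>2 + 2 * v * a\<^sup>2"
proof -
  show e: "expectation (\<lambda>\<omega>. X \<omega> * Y \<omega>) = a\<^sup>2"
    using indep_var_lebesgue_integral[OF ind int(1,2)] ex by (simp add: power2_eq_square)
  have ind2: "indep_var borel (\<lambda>\<omega>. (X \<omega>)\<^sup>2) borel (\<lambda>\<omega>. (Y \<omega>)\<^sup>2)"
    using indep_var_compose[OF ind, of "\<lambda>x. x\<^sup>2" borel "\<lambda>x. x\<^sup>2" borel] by (simp add: comp_def)
  have X: "expectation (\<lambda>\<omega>. (X \<omega>)\<^sup>2) \<le> v + a\<^sup>2" and Y: "expectation (\<lambda>\<omega>. (Y \<omega>)\<^sup>2) \<le> v + a\<^sup>2"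
    using var variance_eq[OF int(1,3)] variance_eq[OF int(2,4)] ex by auto
  have sq: "integrable M (\<lambda>\<omega>. (X \<omega> * Y \<omega>)\<^sup>2)"
    using indep_var_integrable[OF ind2 int(3,4)] by (simp add: power_mult_distrib)
  have "variance (\<lambda>\<omega>. X \<omega> * Y \<omega>) = expectation (\<lambda>\<omega>. (X \<omega> * Y \<omega>)\<^sup>2) - (a\<^sup>2)\<^sup>2"
    using variance_eq[OF indep_var_integrable[OF ind int(1,2)] sq] e by simp
  also have "\<dots> = expectation (\<lambda>\<omega>. (X \<omega>)\<^sup>2) * expectation (\<lambda>\<omega>. (Y \<omega>)\<^sup>2) - (a\<^sup>2)\<^sup>2"
    using indep_var_lebesgue_integral[OF ind2 int(3,4)] by (simp add: power_mult_distrib)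
  also have "\<dots> \<le> (v + a\<^sup>2) * (v + a\<^sup>2) - (a\<^sup>2)\<^sup>2"
    using order.trans[OF variance_positive var(1)]
    by (intro diff_right_mono mult_mono X Y) (auto intro!: add_nonneg_nonneg)
  also have "\<dots> = v\<^sup>2 + 2 * v * a\<^sup>2"
    by (simp add: power2_eq_square algebra_simps)
  finally show "variance (\<lambda>\<omega>. X \<omega> * Y \<omega>) \<le> v\<^sup>2 + 2 * v * a\<^sup>2" .
qed

text \<open>Markov's inequality for the product of the \<open>16 powr indicator (F r)\<close>.\<close>

lemma (in prob_space) majority_failure_bound:
  fixes F :: "nat \<Rightarrow> 'a set"
  assumes F: "\<And>r. r < R \<Longrightarrow> F r \<in> events" "\<And>r. r < R \<Longrightarrow> prob (F r) \<le> 1 / 16"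
    and ind: "indep_vars (\<lambda>_. borel) (\<lambda>r. indicator (F r) :: 'a \<Rightarrow> real) {..<R}"
    and R: "R \<ge> 1"
    and E: "E \<in> events" "\<And>\<omega>. \<omega> \<in> E \<Longrightarrow> R \<le> 2 * card {r. r < R \<and> \<omega> \<in> F r}"
  shows "prob E < (1 / 2) ^ R"
proof -
  \<comment> \<open>\<open>G r\<close> is \<open>16\<close> on \<open>F r\<close> and
    \<open>1\<close> elsewhere; the affine form gives its expectation directly, at most
    \<open>1 + 15 / 16\<close>.\<close>
  define G :: "nat \<Rightarrow> 'a \<Rightarrow> real" where "G r \<omega> = 1 + 15 * indicator (F r) \<omega>" for r \<omega>
  have indG: "indep_vars (\<lambda>_. borel) G {..<R}"
    unfolding G_def using ind
    by (rule indep_vars_compose2[where Y = "\<lambda>_ x. 1 + 15 * x"]) auto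
  have intG: "integrable M (G r)" if "r < R" for r
    using F(1)[OF that] unfolding G_def
    by (intro Bochner_Integration.integrable_add integrable_mult_right integrable_const)
      (auto intro!: integrable_real_indicator simp: emeasure_eq_measure)
  have EG: "expectation (G r) \<le> 31 / 16" if "r < R" for r
    proof -
    have "expectation (G r) = 1 + 15 * prob (F r)"
      unfolding G_def using F(1)[OF that]
      by (subst Bochner_Integration.integral_add)
        (auto simp: prob_space emeasure_eq_measure intro!: integrable_real_indicator)
    with F(2)[OF that] show ?thesis by simp
  qed
  have int: "integrable M (\<lambda>\<omega>. \<Prod>r<R. G r \<omega>)"
    by (intro indep_vars_integrable indG) (auto intro: intG)
  have lower: "4 ^ R * indicator E \<omega> \<le> (\<Prod>r<R. G r \<omega>)" for \<omega>
  proof (cases "\<omega> \<in> E")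
    case True
    have "(\<Prod>r<R. G r \<omega>) = (\<Prod>r<R. if \<omega> \<in> F r then 16 else 1)"
      by (intro prod.cong) (auto simp: G_def)
    also have "\<dots> = (\<Prod>r\<in>{r. r < R \<and> \<omega> \<in> F r}. 16)"
      by (subst prod.inter_filter[symmetric]) (auto intro!: prod.cong)
    \<comment> \<open>On \<open>E\<close> at least half of the \<open>R\<close> factors are
      \<open>16 = 4 ^ 2\<close>, hence the lower bound \<open>4 ^ R\<close>.\<close>
    also have "\<dots> = 4 ^ (2 * card {r. r < R \<and> \<omega> \<in> F r})"
      by (simp add: power_mult)
    finally show ?thesis
      using True E(2)[OF True] by (simp add: power_increasing)
  qed (auto intro!: prod_nonneg simp: G_def)
  have "4 ^ R * prob E = expectation (\<lambda>\<omega>. 4 ^ R * indicator E \<omega>)"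
    using E(1) by simp
  also have "\<dots> \<le> expectation (\<lambda>\<omega>. \<Prod>r<R. G r \<omega>)"
    using E(1) by (intro integral_mono int lower)
      (auto intro!: integrable_real_indicator simp: emeasure_eq_measure)
  also have "\<dots> = (\<Prod>r<R. expectation (G r))"
    by (intro indep_vars_lebesgue_integral indG) (auto intro: intG)
  also have "\<dots> \<le> (\<Prod>r<R. 31 / 16)"
    using EG by (intro prod_mono) (auto simp: G_def intro!: Bochner_Integration.integral_nonneg)
  \<comment> \<open>Strict since \<open>31 / 16 < 2\<close> and \<open>R \<ge> 1\<close>; the
    success probabilities must lie strictly above \<open>1 - \<delta>\<close>.\<close>
  also have "\<dots> < 2 ^ R"
    using R by (simp add: power_strict_mono del: power_divide)
  finally have "4 ^ R * prob E < 2 ^ R" .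
  moreover have "(4::real) ^ R = 2 ^ R * 2 ^ R"
    by (simp flip: power_mult_distrib)
  ultimately show ?thesis
    by (simp add: power_divide field_simps)
qed

section \<open>Hadamard matrices\<close>

text \<open>Sylvester's Hadamard matrix of order \<open>2 ^ m\<close>, with rows and columns indexed from \<open>0\<close>.\<close>

fun had :: "nat \<Rightarrow> nat \<Rightarrow> nat \<Rightarrow> real" where
  "had 0 i x = 1"
| "had (Suc m) i x = (if odd i \<and> odd x then - 1 else 1) * had m (i div 2) (x div 2)"

lemma abs_had [simp]: "\<bar>had m i x\<bar> = 1"
  by (induction m i x rule: had.induct) (auto simp: abs_mult)

lemma sum_lessThan_double:
  fixes f :: "nat \<Rightarrow> 'a::comm_monoid_add"
  shows "(\<Sum>i<2 * n. f i) = (\<Sum>i<n. f (2 * i) + f (2 * i + 1))"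
  by (induction n) (auto simp: add_ac)

text \<open>Rows \<open>2 * i\<close> and \<open>2 * i + 1\<close> agree up to a sign flip in the
  odd columns. Each such pair therefore contributes twice the term of order \<open>2 ^ m\<close> if
  \<open>x\<close> and \<open>y\<close> have equal parity, and nothing otherwise.\<close>

lemma had_orthogonal:
  "x < 2 ^ m \<Longrightarrow> y < 2 ^ m \<Longrightarrow>
     (\<Sum>i<2 ^ m. had m i x * had m i y) = (if x = y then 2 ^ m else 0)"
proof (induction m arbitrary: x y)
  case (Suc m)
  let ?s = "\<Sum>i<2 ^ m. had m i (x div 2) * had m i (y div 2)"
  have "(\<Sum>i<2 ^ Suc m. had (Suc m) i x * had (Suc m) i y)
          = (1 + (if odd x = odd y then 1 else - 1)) * ?s"
    unfolding power_Suc sum_lessThan_double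
    by (auto simp: sum_distrib_left intro!: sum.cong)
  also have "?s = (if x div 2 = y div 2 then 2 ^ m else 0)"
    using Suc.prems by (intro Suc.IH) auto
  also have "x div 2 = y div 2 \<and> odd x = odd y \<longleftrightarrow> x = y"
    by (metis even_iff_mod_2_eq_zero odd_iff_mod_2_eq_one mult_div_mod_eq)
  then have "(1 + (if odd x = odd y then 1 else - 1)) * (if x div 2 = y div 2 then 2 ^ m else 0)
          = (if x = y then 2 ^ Suc m else (0::real))"
    by auto
  finally show ?case .
qed auto

text \<open>Expanding the squares and summing over the rows first leaves only the diagonal, by
  orthogonality of the columns. Truncating at \<open>k\<close> amounts to padding \<open>v\<close>
  with zeros.\<close>

lemma had_parseval:
  fixes v :: "nat \<Rightarrow> real"
  assumes "k \<le> 2 ^ m"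
  shows "(\<Sum>i<2 ^ m. (\<Sum>x<k. had m i x * v x)\<^sup>2) = 2 ^ m * (\<Sum>x<k. (v x)\<^sup>2)"
proof -
  have "(\<Sum>i<2 ^ m. (\<Sum>x<k. had m i x * v x)\<^sup>2)
      = (\<Sum>i<2 ^ m. \<Sum>x<k. \<Sum>y<k. v x * v y * (had m i x * had m i y))"
    by (simp add: power2_eq_square sum_product mult_ac)
  also have "\<dots> = (\<Sum>x<k. \<Sum>y<k. \<Sum>i<2 ^ m. v x * v y * (had m i x * had m i y))"
    by (subst sum.swap, rule sum.cong[OF refl], rule sum.swap)
  also have "\<dots> = (\<Sum>x<k. \<Sum>y<k. if x = y then v x * v y * 2 ^ m else 0)"
    using assms by (intro sum.cong refl) (auto simp flip: sum_distrib_left simp: had_orthogonal)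
  also have "\<dots> = 2 ^ m * (\<Sum>x<k. (v x)\<^sup>2)"
    by (simp add: sum_distrib_left power2_eq_square mult_ac)
  finally show ?thesis .
qed

section \<open>One round of the test\<close>

lemma finite_set_Pi_pmf:
  fixes p :: "'i \<Rightarrow> 'b::finite pmf"
  shows "finite A \<Longrightarrow> finite (set_pmf (Pi_pmf A d p))"
  by (rule finite_subset[OF set_Pi_pmf_subset']) auto

lemma expectation_Pi_pmf_component:
  fixes h :: "'b \<Rightarrow> real"
  assumes "finite A" "i \<in> A"
  shows "measure_pmf.expectation (Pi_pmf A d p) (\<lambda>\<omega>. h (\<omega> i)) = measure_pmf.expectation (p i) h"
proof -
  have "measure_pmf.expectation (p i) h = measure_pmf.expectation (map_pmf (\<lambda>\<omega>. \<omega> i) (Pi_pmf A d p)) h"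
    using assms by (subst Pi_pmf_component) auto
  then show ?thesis by simp
qed

text \<open>Multiplying two independent half sums, instead of squaring one sum, makes the
  expectation the square of the mean, with no variance term to subtract.\<close>

definition pair_stat ::
  "nat \<Rightarrow> (nat \<Rightarrow> bool \<Rightarrow> 'i set) \<Rightarrow> ('i \<Rightarrow> 'b \<Rightarrow> real) \<Rightarrow> ('i \<Rightarrow> 'b) \<Rightarrow> real" where
  "pair_stat K S g \<omega> = (\<Sum>j<K. (\<Sum>i\<in>S j True. g i (\<omega> i)) * (\<Sum>i\<in>S j False. g i (\<omega> i)))"

text \<open>Both half sums of row \<open>j\<close> have mean \<open>m * \<Delta> j\<close> and
  variance at most \<open>m\<close>, so \<open>variance_mult_indep_le\<close> handles one row.
  Different rows read disjoint coordinates, so their variances add.\<close>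

lemma pair_stat_moments:
  fixes B :: "'i \<Rightarrow> 'b::finite pmf" and g :: "'i \<Rightarrow> 'b \<Rightarrow> real"
  assumes A: "finite A"
    and S: "\<And>j b. j < K \<Longrightarrow> S j b \<subseteq> A" "\<And>j b. j < K \<Longrightarrow> card (S j b) = m"
    and disj: "\<And>i j b j' b'. j < K \<Longrightarrow> j' < K \<Longrightarrow> i \<in> S j b \<Longrightarrow> i \<in> S j' b' \<Longrightarrow> j = j' \<and> b = b'"
    and g: "\<And>i j b. j < K \<Longrightarrow> i \<in> S j b \<Longrightarrow> measure_pmf.expectation (B i) (g i) = \<Delta> j"
           "\<And>i j b. j < K \<Longrightarrow> i \<in> S j b \<Longrightarrow> measure_pmf.variance (B i) (g i) \<le> 1"
  shows "measure_pmf.expectation (Pi_pmf A d B) (pair_stat K S g) = (real m)\<^sup>2 * (\<Sum>j<K. (\<Delta> j)\<^sup>2)"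
    and "measure_pmf.variance (Pi_pmf A d B) (pair_stat K S g) \<le>
           real K * (real m)\<^sup>2 + 2 * real m ^ 3 * (\<Sum>j<K. (\<Delta> j)\<^sup>2)"
proof -
  define M where "M = Pi_pmf A d B"
  have int: "integrable M f" for f :: "_ \<Rightarrow> real"
    unfolding M_def by (intro integrable_measure_pmf_finite finite_set_Pi_pmf A)
  define X where "X i \<omega> = g i (\<omega> i)" for i and \<omega> :: "'i \<Rightarrow> 'b"
  define Z where "Z j b \<omega> = (\<Sum>i\<in>S j b. X i \<omega>)" for j b \<omega>
  define W where "W j \<omega> = Z j True \<omega> * Z j False \<omega>" for j \<omega>
  have pair_stat: "pair_stat K S g = (\<lambda>\<omega>. \<Sum>j<K. W j \<omega>)"
    by (auto simp: pair_stat_def W_def Z_def X_def)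
  have finS: "finite (S j b)" if "j < K" for j b
    using S(1)[OF that] A by (rule finite_subset)
  have Z_cong: "Z j b \<omega> = Z j b \<omega>'" if "\<And>i. i \<in> S j b \<Longrightarrow> \<omega> i = \<omega>' i" for j b \<omega> \<omega>'
    using that by (auto simp: Z_def X_def intro!: sum.cong)
  have EX: "measure_pmf.expectation M (X i) = \<Delta> j" and VX: "measure_pmf.variance M (X i) \<le> 1"
    if "j < K" "i \<in> S j b" for i j b
  proof -
    have i: "i \<in> A" using S that by auto
    show e: "measure_pmf.expectation M (X i) = \<Delta> j"
      unfolding X_def M_def
      using g(1)[OF that] by (subst expectation_Pi_pmf_component[OF A i]) simp
    \<comment> \<open>With both means replaced by \<open>\<Delta> j\<close>, the variance is the
      expectation of a function of coordinate \<open>i\<close> alone.\<close>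
    have "measure_pmf.variance M (X i) = measure_pmf.variance (B i) (g i)"
      unfolding e g(1)[OF that] unfolding X_def M_def
      by (rule expectation_Pi_pmf_component[OF A i])
    with g(2)[OF that] show "measure_pmf.variance M (X i) \<le> 1" by simp
  qed
  have EZ: "measure_pmf.expectation M (Z j b) = m * \<Delta> j" and VZ: "measure_pmf.variance M (Z j b) \<le> m" if j: "j < K" for j b
  proof -
    show "measure_pmf.expectation M (Z j b) = m * \<Delta> j"
      unfolding Z_def using j int EX[OF j] S(2)[OF j] by (simp add: Bochner_Integration.integral_sum)
    have "prob_space.indep_vars M (\<lambda>_. borel) X (S j b)"
      unfolding M_def using S(1)[OF j, of b]
      by (intro indep_vars_Pi_pmf_disjoint[OF A, where S = "\<lambda>i. {i}"])
        (auto simp: X_def disjoint_family_on_def)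
    then have "measure_pmf.variance M (Z j b) = (\<Sum>i\<in>S j b. measure_pmf.variance M (X i))"
      unfolding Z_def by (intro measure_pmf.variance_sum_indep finS j int)
    also have "\<dots> \<le> (\<Sum>i\<in>S j b. 1)"
      by (intro sum_mono VX[OF j])
    finally show "measure_pmf.variance M (Z j b) \<le> m"
      using S(2)[OF j] by simp
  qed
  have EW: "measure_pmf.expectation M (W j) = (m * \<Delta> j)\<^sup>2"
    and VW: "measure_pmf.variance M (W j) \<le> (real m)\<^sup>2 + 2 * real m * (m * \<Delta> j)\<^sup>2" if j: "j < K" for j
  proof -
    have "prob_space.indep_vars M (\<lambda>_. borel) (Z j) UNIV"
      unfolding M_def
    proof (intro indep_vars_Pi_pmf_disjoint[OF A, where S = "S j"] Z_cong)
      show "disjoint_family_on (S j) UNIV"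
        unfolding disjoint_family_on_def using disj[OF j j] by blast
    qed (use S(1)[OF j] in auto)
    \<comment> \<open>\<open>indep_var\<close> is \<open>indep_vars\<close> over the index type
      \<open>bool\<close>, which is also the type labelling the two halves.\<close>
    then have "prob_space.indep_var M borel (Z j True) borel (Z j False)"
      unfolding prob_space.indep_var_def[OF measure_pmf.prob_space_axioms]
      by (rule iffD1[OF prob_space.indep_vars_cong[OF measure_pmf.prob_space_axioms], rotated -1]) (auto split: bool.split)
    note * = measure_pmf.variance_mult_indep_le[OF this int int int int EZ[OF j] EZ[OF j] VZ[OF j] VZ[OF j]]
    show "measure_pmf.expectation M (W j) = (m * \<Delta> j)\<^sup>2"
      unfolding W_def by (rule *)
    show "measure_pmf.variance M (W j) \<le> (real m)\<^sup>2 + 2 * real m * (m * \<Delta> j)\<^sup>2"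
      unfolding W_def by (rule *)
  qed
  show "measure_pmf.expectation (Pi_pmf A d B) (pair_stat K S g) = (real m)\<^sup>2 * (\<Sum>j<K. (\<Delta> j)\<^sup>2)"
    unfolding pair_stat M_def[symmetric]
    by (subst Bochner_Integration.integral_sum)
      (auto simp: int EW sum_distrib_left power_mult_distrib)
  have "prob_space.indep_vars M (\<lambda>_. borel) W {..<K}"
    unfolding M_def
  proof (intro indep_vars_Pi_pmf_disjoint[OF A, where S = "\<lambda>j. S j True \<union> S j False"])
    show "disjoint_family_on (\<lambda>j. S j True \<union> S j False) {..<K}"
      unfolding disjoint_family_on_def using disj by blast
    show "W j \<omega> = W j \<omega>'" if "\<And>i. i \<in> S j True \<union> S j False \<Longrightarrow> \<omega> i = \<omega>' i" for j \<omega> \<omega>'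
      unfolding W_def using that by (intro arg_cong2[where f = "(*)"] Z_cong) auto
  qed (use S(1) in auto)
  then have "measure_pmf.variance M (\<lambda>\<omega>. \<Sum>j<K. W j \<omega>) = (\<Sum>j<K. measure_pmf.variance M (W j))"
    by (intro measure_pmf.variance_sum_indep int) auto
  also have "\<dots> \<le> (\<Sum>j<K. (real m)\<^sup>2 + 2 * real m * (m * \<Delta> j)\<^sup>2)"
    by (intro sum_mono VW) auto
  also have "\<dots> = real K * (real m)\<^sup>2 + 2 * real m ^ 3 * (\<Sum>j<K. (\<Delta> j)\<^sup>2)"
    by (simp add: sum.distrib sum_distrib_left power2_eq_square power3_eq_cube mult_ac)
  finally show "measure_pmf.variance (Pi_pmf A d B) (pair_stat K S g) \<le>
           real K * (real m)\<^sup>2 + 2 * real m ^ 3 * (\<Sum>j<K. (\<Delta> j)\<^sup>2)"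
    unfolding pair_stat M_def[symmetric] .
qed

lemma threshold_test_error:
  fixes M :: "'a pmf" and T :: "'a \<Rightarrow> real"
  assumes int: "integrable M T" "integrable M (\<lambda>\<omega>. (T \<omega>)\<^sup>2)"
    and ex: "measure_pmf.expectation M T = (real m)\<^sup>2 * D"
    and var: "measure_pmf.variance M T \<le> real K * (real m)\<^sup>2 + 2 * real m ^ 3 * D"
    and K: "K \<ge> 1" and D0: "D0 > 0" "real m * D0 \<ge> 160 * sqrt K"
  shows "D = 0 \<Longrightarrow> measure_pmf.prob M {\<omega>. T \<omega> > (real m)\<^sup>2 * D0 / 2} \<le> 1 / 16"
    and "D \<ge> D0 \<Longrightarrow> measure_pmf.prob M {\<omega>. T \<omega> \<le> (real m)\<^sup>2 * D0 / 2} \<le> 1 / 16"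
proof -
  have sK: "sqrt K \<ge> 1" using K by simp
  have mD0: "real m * D0 > 0" using sK D0 by linarith
  then have m: "real m > 0" using D0(1) by (simp add: zero_less_mult_iff)
  have cheb: "measure_pmf.prob M {\<omega>. \<bar>T \<omega> - (real m)\<^sup>2 * D\<bar> \<ge> a}
                \<le> (real K * (real m)\<^sup>2 + 2 * real m ^ 3 * D) / a\<^sup>2" if "a > 0" for a
  proof -
    have "measure_pmf.prob M {\<omega> \<in> space M. \<bar>T \<omega> - measure_pmf.expectation M T\<bar> \<ge> a}
            \<le> measure_pmf.variance M T / a\<^sup>2"
      by (rule measure_pmf.Chebyshev_inequality) (use that int in auto)
    also have "\<dots> \<le> (real K * (real m)\<^sup>2 + 2 * real m ^ 3 * D) / a\<^sup>2"
      by (intro divide_right_mono var) auto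
    finally show ?thesis by (simp add: ex)
  qed
  have sq: "(160 * sqrt K)\<^sup>2 \<le> (real m * x)\<^sup>2" if "x \<ge> D0" for x
  proof (intro power_mono)
    show "160 * sqrt K \<le> real m * x"
      using mult_left_mono[OF that, of "real m"] D0(2) by linarith
  qed (use sK in linarith)
  \<comment> \<open>The quotient is \<open>4 * K / (m * x)\<^sup>2\<close>, and
    \<open>25600 = 160\<^sup>2\<close>.\<close>
  have var1: "real K * (real m)\<^sup>2 / ((real m)\<^sup>2 * x / 2)\<^sup>2 \<le> 4 / 25600" if "x \<ge> D0" for x
  proof -
    have "25600 * real K \<le> (real m * x)\<^sup>2"
      using sq[OF that] by (simp add: power_mult_distrib)
    moreover have "(real m * x)\<^sup>2 > 0" using D0 that m by simp
    ultimately have "4 * real K / (real m * x)\<^sup>2 \<le> 4 / 25600"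
      by (subst pos_divide_le_eq) auto
    moreover have "real K * (real m)\<^sup>2 / ((real m)\<^sup>2 * x / 2)\<^sup>2 = 4 * real K / (real m * x)\<^sup>2"
    proof -
      have "((real m)\<^sup>2 * x / 2)\<^sup>2 = (real m)\<^sup>2 * ((real m * x)\<^sup>2 / 4)"
        by (simp add: power2_eq_square)
      then show ?thesis using m by (simp only:) simp
    qed
    ultimately show ?thesis by linarith
  qed
  show "measure_pmf.prob M {\<omega>. T \<omega> > (real m)\<^sup>2 * D0 / 2} \<le> 1 / 16" if "D = 0"
  proof -
    have "measure_pmf.prob M {\<omega>. T \<omega> > (real m)\<^sup>2 * D0 / 2}
            \<le> measure_pmf.prob M {\<omega>. \<bar>T \<omega> - (real m)\<^sup>2 * D\<bar> \<ge> (real m)\<^sup>2 * D0 / 2}"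
      using that by (intro measure_pmf.finite_measure_mono) auto
    also have "\<dots> \<le> real K * (real m)\<^sup>2 / ((real m)\<^sup>2 * D0 / 2)\<^sup>2"
    proof -
      have "0 < (real m)\<^sup>2 * D0 / 2" using m D0(1) by simp
      from cheb[OF this] show ?thesis unfolding that mult_zero_right add_0_right .
    qed
    also have "\<dots> \<le> 4 / 25600" by (rule var1) simp
    finally show ?thesis by simp
  qed
  show "measure_pmf.prob M {\<omega>. T \<omega> \<le> (real m)\<^sup>2 * D0 / 2} \<le> 1 / 16" if D: "D \<ge> D0"
  proof -
    have Dpos: "D > 0" using D D0 by linarith
    have le: "(real m)\<^sup>2 * D0 \<le> (real m)\<^sup>2 * D" using D by (intro mult_left_mono) auto
    have mD: "real m * D \<ge> 160"
      using mult_left_mono[OF D, of "real m"] D0 sK m by linarith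
    \<comment> \<open>Since \<open>D0 \<le> D\<close>, the threshold lies at least
      \<open>m\<^sup>2 * D / 2\<close> below the mean.\<close>
    have "measure_pmf.prob M {\<omega>. T \<omega> \<le> (real m)\<^sup>2 * D0 / 2}
            \<le> measure_pmf.prob M {\<omega>. \<bar>T \<omega> - (real m)\<^sup>2 * D\<bar> \<ge> (real m)\<^sup>2 * D / 2}"
    proof (intro measure_pmf.finite_measure_mono subsetI CollectI)
      fix \<omega> assume "\<omega> \<in> {\<omega>. T \<omega> \<le> (real m)\<^sup>2 * D0 / 2}"
      then show "\<bar>T \<omega> - (real m)\<^sup>2 * D\<bar> \<ge> (real m)\<^sup>2 * D / 2"
        using le abs_ge_minus_self[of "T \<omega> - (real m)\<^sup>2 * D"] by simp
    qed simp
    also have "\<dots> \<le> (real K * (real m)\<^sup>2 + 2 * real m ^ 3 * D) / ((real m)\<^sup>2 * D / 2)\<^sup>2"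
      using m Dpos by (intro cheb) auto
    also have "\<dots> = real K * (real m)\<^sup>2 / ((real m)\<^sup>2 * D / 2)\<^sup>2 + 8 / (real m * D)"
    proof -
      have "((real m)\<^sup>2 * D / 2)\<^sup>2 = (real m ^ 3 * D) * (real m * D / 4)"
        by (simp add: power2_eq_square power3_eq_cube)
      then have "2 * real m ^ 3 * D / ((real m)\<^sup>2 * D / 2)\<^sup>2
                   = 2 * (real m ^ 3 * D) / ((real m ^ 3 * D) * (real m * D / 4))"
        by (simp only: mult.assoc)
      also have "\<dots> = 8 / (real m * D)"
        using m Dpos by simp
      finally show ?thesis by (simp only: add_divide_distrib)
    qed
    \<comment> \<open>The sum is just above \<open>0.05\<close>, below
      \<open>1 / 16\<close>.\<close>
    also have "\<dots> \<le> 4 / 25600 + 8 / 160"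
      using mD by (intro add_mono var1 D divide_left_mono) auto
    finally show ?thesis by simp
  qed
qed

section \<open>The protocol\<close>

text \<open>
  Players are cut into consecutive blocks of \<open>m\<close>. Block number \<open>2 * (r * K + j) + b\<close> (from \<open>0\<close>) is
  half \<open>b\<close> of the sample for row \<open>j\<close> in round \<open>r\<close>.
\<close>

definition cell :: "nat \<Rightarrow> nat \<Rightarrow> nat \<Rightarrow> nat \<Rightarrow> bool \<Rightarrow> nat set" where
  "cell K m r j b = {i. 1 \<le> i \<and> (i - 1) div m = 2 * (r * K + j) + of_bool b}"

text \<open>Decodes the block number: \<open>div 2\<close> drops the half and \<open>mod K\<close>
  drops the round.\<close>

definition row :: "nat \<Rightarrow> nat \<Rightarrow> nat \<Rightarrow> nat" where
  "row K m i = (i - 1) div m div 2 mod K"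

lemma row_cell: "j < K \<Longrightarrow> i \<in> cell K m r j b \<Longrightarrow> row K m i = j"
  by (auto simp: cell_def row_def)

text \<open>The parity of the block number gives \<open>b\<close>; quotient and remainder of its
  half by \<open>K\<close> give \<open>r\<close> and \<open>j\<close>.\<close>

lemma cell_disjoint:
  assumes "j < K" "j' < K" "i \<in> cell K m r j b" "i \<in> cell K m r' j' b'"
  shows "r = r' \<and> j = j' \<and> b = b'"
proof -
  have eq: "2 * (r * K + j) + of_bool b = 2 * (r' * K + j') + (of_bool b' :: nat)"
    using assms by (auto simp: cell_def)
  have b: "b = b'"
    using arg_cong[OF eq, of even] by (auto split: if_splits)
  with eq have "r * K + j = r' * K + j'" by simp
  from arg_cong[OF this, of "\<lambda>x. x div K"] arg_cong[OF this, of "\<lambda>x. x mod K"] show ?thesis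
    using assms b by simp
qed

lemma card_cell:
  assumes "m > 0"
  shows "card (cell K m r j b) = m"
proof -
  define c where "c = 2 * (r * K + j) + (of_bool b :: nat)"
  \<comment> \<open>The interval is shifted by one because players are numbered from
    \<open>1\<close>.\<close>
  have "cell K m r j b = {c * m + 1..c * m + m}"
  proof (intro set_eqI iffI)
    fix i assume "i \<in> cell K m r j b"
    then have "1 \<le> i" "(i - 1) div m = c" by (auto simp: cell_def c_def)
    then have "(i - 1) div m * m = c * m" by simp
    with \<open>1 \<le> i\<close> show "i \<in> {c * m + 1..c * m + m}"
      using div_times_less_eq_dividend[of "i - 1" m] dividend_less_div_times[OF assms, of "i - 1"]
      unfolding atLeastAtMost_iff by linarith
  next
    fix i assume i: "i \<in> {c * m + 1..c * m + m}"
    then have "(i - 1) div m = c"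
      using assms by (intro div_nat_eqI) (auto simp: mult.commute)
    with i show "i \<in> cell K m r j b" by (auto simp: cell_def c_def)
  qed
  then show ?thesis by simp
qed

lemma cell_subset:
  assumes "m > 0" "j < K" "r < R" "2 * m * K * R \<le> n"
  shows "cell K m r j b \<subseteq> {1..n}"
proof
  fix i assume i: "i \<in> cell K m r j b"
  have "Suc r * K \<le> R * K" using assms by (intro mult_le_mono1) simp
  then have "r * K + j + 1 \<le> R * K" using assms by simp
  then have "(i - 1) div m + 1 \<le> 2 * (R * K)" using i by (auto simp: cell_def)
  then have "((i - 1) div m + 1) * m \<le> 2 * (R * K) * m" by (rule mult_le_mono1)
  moreover have "i - 1 < ((i - 1) div m + 1) * m"
    using dividend_less_div_times[OF assms(1), of "i - 1"] by (simp add: algebra_simps)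
  ultimately have "i - 1 < n" using assms(4) by (simp add: mult_ac)
  with i show "i \<in> {1..n}" by (auto simp: cell_def)
qed

text \<open>Coins, samples and channel noise are independent across players, so the three nested
  products merge into one. All independence between messages is read off from this form.\<close>

lemma messages_eq_Pi_pmf:
  "messages n P p =
     Pi_pmf {1..n} undefined (\<lambda>i. bind_pmf (coin P i) (\<lambda>u. bind_pmf p (channel P i u)))"
  unfolding messages_def
  by (simp add: Pi_pmf_bind[where d' = undefined])

section \<open>Randomized response on a Hadamard row\<close>

abbreviation sgn_bit :: "bool \<Rightarrow> real" where
  "sgn_bit b \<equiv> (if b then 1 else - 1)"

text \<open>Symbol \<open>x \<in> {1..k}\<close> corresponds to column \<open>x - 1\<close> of the Hadamard matrix.\<close>

definition row_mean :: "nat \<Rightarrow> nat \<Rightarrow> nat \<Rightarrow> real \<Rightarrow> nat pmf \<Rightarrow> real" where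
  "row_mean k e j \<alpha> p = \<alpha> * (\<Sum>x<k. had e j x * pmf p (Suc x))"

definition row_channel :: "nat \<Rightarrow> nat \<Rightarrow> real \<Rightarrow> nat \<Rightarrow> bool pmf" where
  "row_channel e j \<alpha> x = bernoulli_pmf ((1 + \<alpha> * had e j (x - 1)) / 2)"

lemma had_cases: "had e j x = 1 \<or> had e j x = - 1"
  using abs_had[of e j x] by linarith

text \<open>Bit probabilities lie between \<open>(1 - \<rho> / 4) / 2\<close> and
  \<open>(1 + \<rho> / 4) / 2\<close>. Their ratio is at most \<open>1 + \<rho>\<close>, hence at
  most \<open>exp \<rho>\<close>, because \<open>\<rho> \<le> 1\<close>.\<close>

lemma row_channel_LDP:
  assumes "0 < \<rho>" "\<rho> \<le> 1"
  shows "LDP A \<rho> (row_channel e j (\<rho> / 4))"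
  unfolding LDP_def
proof (intro allI ballI)
  fix y x x'
  have "1 + \<rho> / 4 \<le> (1 + \<rho>) * (1 - \<rho> / 4)"
  proof -
    have "(1 + \<rho>) * (1 - \<rho> / 4) - (1 + \<rho> / 4) = \<rho> * (2 - \<rho>) / 4"
      by (simp add: field_simps)
    also have "\<dots> \<ge> 0" using assms by simp
    finally show ?thesis by simp
  qed
  also have "\<dots> \<le> exp \<rho> * (1 - \<rho> / 4)"
    using assms exp_ge_add_one_self by (intro mult_right_mono) auto
  finally have *: "(1 + \<rho> / 4) / 2 \<le> exp \<rho> * ((1 - \<rho> / 4) / 2)" by simp
  have "pmf (row_channel e j (\<rho> / 4) x') y \<le> (1 + \<rho> / 4) / 2"
    using had_cases[of e j "x' - 1"] assms by (cases y) (auto simp: row_channel_def field_simps)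
  also note *
  also have "exp \<rho> * ((1 - \<rho> / 4) / 2) \<le> exp \<rho> * pmf (row_channel e j (\<rho> / 4) x) y"
    using had_cases[of e j "x - 1"] assms
    by (intro mult_left_mono) (cases y, auto simp: row_channel_def field_simps)
  finally show "pmf (row_channel e j (\<rho> / 4) x') y \<le> exp \<rho> * pmf (row_channel e j (\<rho> / 4) x) y" .
qed

text \<open>The signed bit has square \<open>1\<close>, so its variance is at most \<open>1\<close>,
  and shifting by \<open>\<mu>\<close> does not change it. In the test, \<open>\<mu>\<close> is the
  mean under the reference distribution.\<close>

lemma row_channel_moments:
  fixes e j :: nat
  assumes p: "distribution_on k p" and \<alpha>: "0 \<le> \<alpha>" "\<alpha> \<le> 1"
  defines "B \<equiv> bind_pmf p (row_channel e j \<alpha>)"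
  shows "measure_pmf.expectation B (\<lambda>b. sgn_bit b - \<mu>) = row_mean k e j \<alpha> p - \<mu>"
    and "measure_pmf.variance B (\<lambda>b. sgn_bit b - \<mu>) \<le> 1"
proof -
  have int: "integrable B f" for f :: "bool \<Rightarrow> real"
    by (intro integrable_measure_pmf_finite) auto
  have E1: "measure_pmf.expectation (row_channel e j \<alpha> x) sgn_bit = \<alpha> * had e j (x - 1)" for x
    using had_cases[of e j "x - 1"] \<alpha> by (auto simp: row_channel_def field_simps)
  have E: "measure_pmf.expectation B sgn_bit = row_mean k e j \<alpha> p"
  proof -
    have "measure_pmf.expectation B sgn_bit
            = (\<Sum>x\<in>{1..k}. pmf p x *\<^sub>R measure_pmf.expectation (row_channel e j \<alpha> x) sgn_bit)"
      unfolding B_def using p by (intro pmf_expectation_bind) (auto simp: distribution_on_def)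
    also have "\<dots> = (\<Sum>x<k. pmf p (Suc x) * (\<alpha> * had e j x))"
      unfolding E1 by (simp add: sum.atLeast1_atMost_eq)
    also have "\<dots> = row_mean k e j \<alpha> p"
      by (simp add: row_mean_def sum_distrib_left mult_ac)
    finally show ?thesis .
  qed
  show E\<mu>: "measure_pmf.expectation B (\<lambda>b. sgn_bit b - \<mu>) = row_mean k e j \<alpha> p - \<mu>"
    using E by (subst Bochner_Integration.integral_diff) (auto simp: int)
  have "measure_pmf.variance B (\<lambda>b. sgn_bit b - \<mu>) = measure_pmf.variance B sgn_bit"
    unfolding E\<mu> E by simp
  also have "\<dots> = measure_pmf.expectation B (\<lambda>b. (sgn_bit b)\<^sup>2) - (measure_pmf.expectation B sgn_bit)\<^sup>2"
    by (intro measure_pmf.variance_eq int)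
  also have "(\<lambda>b. (sgn_bit b)\<^sup>2) = (\<lambda>_. 1)" by auto
  finally show "measure_pmf.variance B (\<lambda>b. sgn_bit b - \<mu>) \<le> 1" by simp
qed

text \<open>The difference \<open>v\<close> of the two probability vectors has l1 norm above
  \<open>2 * \<epsilon>\<close>. Cauchy-Schwarz bounds the squared l1 norm by
  \<open>k \<le> 2 ^ e\<close> times the squared l2 norm, and Parseval turns that product into the
  sum over rows.\<close>

lemma row_mean_separation:
  assumes k: "k \<le> 2 ^ e" and tv: "tv_dist k p q > \<epsilon>" "\<epsilon> > 0"
  shows "(\<Sum>j<2 ^ e. (row_mean k e j \<alpha> p - row_mean k e j \<alpha> q)\<^sup>2) \<ge> 4 * \<alpha>\<^sup>2 * \<epsilon>\<^sup>2"
proof -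
  define v where "v x = pmf p (Suc x) - pmf q (Suc x)" for x
  have "2 * tv_dist k p q = (\<Sum>x<k. \<bar>v x\<bar>)"
    by (simp add: tv_dist_def v_def sum.atLeast1_atMost_eq)
  then have "(2 * \<epsilon>)\<^sup>2 \<le> (\<Sum>x<k. \<bar>v x\<bar>)\<^sup>2"
    using tv by (intro power_mono) auto
  also have "\<dots> \<le> (\<Sum>x<k. \<bar>v x\<bar>\<^sup>2) * card {..<k}"
    by (rule sum_squared_le_sum_of_squares)
  also have "\<dots> = real k * (\<Sum>x<k. (v x)\<^sup>2)"
    by simp
  also have "\<dots> \<le> 2 ^ e * (\<Sum>x<k. (v x)\<^sup>2)"
    using of_nat_mono[OF k, where 'a = real] by (intro mult_right_mono sum_nonneg) auto
  also have "\<dots> = (\<Sum>j<2 ^ e. (\<Sum>x<k. had e j x * v x)\<^sup>2)"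
    by (rule had_parseval[OF k, symmetric])
  finally have main: "\<alpha>\<^sup>2 * (2 * \<epsilon>)\<^sup>2 \<le> \<alpha>\<^sup>2 * (\<Sum>j<2 ^ e. (\<Sum>x<k. had e j x * v x)\<^sup>2)"
    by (intro mult_left_mono) auto
  have diff: "row_mean k e j \<alpha> p - row_mean k e j \<alpha> q = \<alpha> * (\<Sum>x<k. had e j x * v x)" for j
    by (simp add: row_mean_def v_def right_diff_distrib sum_subtractf)
  have "4 * \<alpha>\<^sup>2 * \<epsilon>\<^sup>2 = \<alpha>\<^sup>2 * (2 * \<epsilon>)\<^sup>2"
    by (simp add: power_mult_distrib)
  also note main
  also have "\<alpha>\<^sup>2 * (\<Sum>j<2 ^ e. (\<Sum>x<k. had e j x * v x)\<^sup>2)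
               = (\<Sum>j<2 ^ e. (row_mean k e j \<alpha> p - row_mean k e j \<alpha> q)\<^sup>2)"
    unfolding diff power_mult_distrib by (rule sum_distrib_left)
  finally show ?thesis .
qed

section \<open>The testing protocol and its error probability\<close>

definition round_stat :: "nat \<Rightarrow> nat \<Rightarrow> nat \<Rightarrow> real \<Rightarrow> nat pmf \<Rightarrow> nat \<Rightarrow> (nat \<Rightarrow> bool) \<Rightarrow> real" where
  "round_stat k e m \<alpha> q r =
     pair_stat (2 ^ e) (cell (2 ^ e) m r) (\<lambda>i b. sgn_bit b - row_mean k e (row (2 ^ e) m i) \<alpha> q)"

text \<open>The coin is trivial because the index of a player fixes its row. The referee reads only
  the blocks of the first \<open>R\<close> rounds, so \<open>n\<close> may exceed their total size.
  A tied vote accepts.\<close>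

definition testing_protocol ::
  "nat \<Rightarrow> nat \<Rightarrow> nat \<Rightarrow> nat \<Rightarrow> real \<Rightarrow> real \<Rightarrow> nat pmf \<Rightarrow> (nat, bool) protocol" where
  "testing_protocol k e m R \<alpha> \<tau> q =
     \<lparr>coin = (\<lambda>_. return_pmf 0),
      channel = (\<lambda>i _. row_channel e (row (2 ^ e) m i) \<alpha>),
      referee = (\<lambda>y. return_pmf (2 * card {r. r < R \<and> round_stat k e m \<alpha> q r y > \<tau>} \<le> R))\<rparr>"

lemma messages_testing_protocol:
  "messages n (testing_protocol k e m R \<alpha> \<tau> q) p =
     Pi_pmf {1..n} undefined (\<lambda>i. bind_pmf p (row_channel e (row (2 ^ e) m i) \<alpha>))"
  by (simp add: messages_eq_Pi_pmf testing_protocol_def bind_return_pmf)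

lemma pmf_verdict_testing_protocol:
  fixes k e m R :: nat and \<alpha> \<tau> :: real and q p :: "nat pmf"
  defines "P \<equiv> testing_protocol k e m R \<alpha> \<tau> q"
  defines "acc \<equiv> \<lambda>y. 2 * card {r. r < R \<and> round_stat k e m \<alpha> q r y > \<tau>} \<le> R"
  shows "pmf (verdict n P p) True = 1 - measure_pmf.prob (messages n P p) {y. \<not> acc y}"
    and "pmf (verdict n P p) False = 1 - measure_pmf.prob (messages n P p) {y. acc y}"
proof -
  have v: "verdict n P p = map_pmf acc (messages n P p)"
    by (simp add: verdict_def P_def testing_protocol_def acc_def map_pmf_def)
  have "acc -` {True} = UNIV - {y. \<not> acc y}" "acc -` {False} = UNIV - {y. acc y}" by auto
  then show "pmf (verdict n P p) True = 1 - measure_pmf.prob (messages n P p) {y. \<not> acc y}"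
    "pmf (verdict n P p) False = 1 - measure_pmf.prob (messages n P p) {y. acc y}"
    unfolding v pmf_map by (simp_all add: measure_pmf.prob_compl[simplified])
qed

text \<open>\<open>D0\<close> equals \<open>4 * (\<rho> / 4)\<^sup>2 * \<epsilon>\<^sup>2\<close>,
  the bound of \<open>row_mean_separation\<close>. Each round then errs with probability at most
  \<open>1 / 16\<close>, and the majority vote amplifies this.\<close>

lemma testing_protocol_correct:
  fixes \<rho> \<epsilon> :: real
  assumes k: "k \<le> 2 ^ e" and R: "R \<ge> 1" and n: "2 * m * 2 ^ e * R \<le> n"
    and \<rho>: "0 < \<rho>" "\<rho> \<le> 1" and \<epsilon>: "0 < \<epsilon>" and q: "distribution_on k q"
    and D0: "D0 = \<rho>\<^sup>2 * \<epsilon>\<^sup>2 / 4" "real m * D0 \<ge> 160 * sqrt (2 ^ e)"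
    and P: "P = testing_protocol k e m R (\<rho> / 4) ((real m)\<^sup>2 * D0 / 2) q"
  shows "pmf (verdict n P q) True > 1 - (1 / 2) ^ R"
    and "distribution_on k p \<Longrightarrow> tv_dist k p q > \<epsilon> \<Longrightarrow> pmf (verdict n P p) False > 1 - (1 / 2) ^ R"
proof -
  define K :: nat where "K = 2 ^ e"
  define T where "T = round_stat k e m (\<rho> / 4) q"
  define \<tau> where "\<tau> = (real m)\<^sup>2 * D0 / 2"
  have D0_pos: "D0 > 0" unfolding D0(1) using \<rho> \<epsilon> by simp
  have "real m * D0 > 0" using D0(2) by (rule less_le_trans[rotated]) simp
  then have m: "m > 0" using D0_pos by (simp add: zero_less_mult_iff)
  have cell: "cell K m r j b \<subseteq> {1..n}" if "j < K" "r < R" for r j b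
    using cell_subset[OF m that] n by (simp add: K_def)
  \<comment> \<open>A round reads only its own cells, which makes the rounds independent.\<close>
  have T_cong: "T r \<omega> = T r \<omega>'" if "\<And>i. i \<in> (\<Union>j<K. \<Union>b. cell K m r j b) \<Longrightarrow> \<omega> i = \<omega>' i" for r \<omega> \<omega>'
    unfolding T_def round_stat_def pair_stat_def K_def[symmetric]
    using that by (intro sum.cong arg_cong2[where f = "(*)"] refl) auto
  \<comment> \<open>\<open>Q\<close> is the event that a round errs: \<open>t > \<tau>\<close> under
    \<open>q\<close>, and \<open>t \<le> \<tau>\<close> under a distant \<open>p\<close>.\<close>
  have majority: "measure_pmf.prob (messages n P p) {y. R \<le> 2 * card {r. r < R \<and> Q (T r y)}} < (1 / 2) ^ R"
    if Q: "\<And>r. r < R \<Longrightarrow> measure_pmf.prob (messages n P p) {y. Q (T r y)} \<le> 1 / 16" for p Q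
  proof (rule measure_pmf.majority_failure_bound[where F = "\<lambda>r. {y. Q (T r y)}"])
    show "prob_space.indep_vars (messages n P p) (\<lambda>_. borel)
            (\<lambda>r. indicator {y. Q (T r y)} :: _ \<Rightarrow> real) {..<R}"
      unfolding P messages_testing_protocol
    proof (rule indep_vars_Pi_pmf_disjoint[where S = "\<lambda>r. \<Union>j<K. \<Union>b. cell K m r j b"])
      show "disjoint_family_on (\<lambda>r. \<Union>j<K. \<Union>b. cell K m r j b) {..<R}"
        unfolding disjoint_family_on_def
      proof (intro ballI impI equals0I)
        fix r r' i assume "r \<noteq> r'"
          and "i \<in> (\<Union>j<K. \<Union>b. cell K m r j b) \<inter> (\<Union>j<K. \<Union>b. cell K m r' j b)"
        then obtain j j' b b' where "j < K" "j' < K" "i \<in> cell K m r j b" "i \<in> cell K m r' j' b'"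
          by auto
        from cell_disjoint[OF this] \<open>r \<noteq> r'\<close> show False by simp
      qed
      show "indicator {y. Q (T r y)} \<omega> = (indicator {y. Q (T r y)} \<omega>' :: real)"
        if "\<And>i. i \<in> (\<Union>j<K. \<Union>b. cell K m r j b) \<Longrightarrow> \<omega> i = \<omega>' i" for r \<omega> \<omega>'
        using T_cong[OF that] by (simp add: indicator_def)
    qed (use cell in auto)
  qed (use R Q in auto)
  define D where "D p = (\<Sum>j<K. (row_mean k e j (\<rho> / 4) p - row_mean k e j (\<rho> / 4) q)\<^sup>2)" for p
  have err: "D p = 0 \<Longrightarrow> measure_pmf.prob (messages n P p) {y. T r y > \<tau>} \<le> 1 / 16"
    "D p \<ge> D0 \<Longrightarrow> measure_pmf.prob (messages n P p) {y. T r y \<le> \<tau>} \<le> 1 / 16"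
    if p: "distribution_on k p" and r: "r < R" for p r
  proof -
    define B where "B i = bind_pmf p (row_channel e (row K m i) (\<rho> / 4))" for i
    define g where "g i b = sgn_bit b - row_mean k e (row K m i) (\<rho> / 4) q" for i b
    define \<Delta> where "\<Delta> j = row_mean k e j (\<rho> / 4) p - row_mean k e j (\<rho> / 4) q" for j
    have M: "messages n P p = Pi_pmf {1..n} undefined B"
      unfolding P messages_testing_protocol B_def K_def ..
    have T: "T r = pair_stat K (cell K m r) g"
      unfolding T_def round_stat_def K_def g_def ..
    have g: "measure_pmf.expectation (B i) (g i) = \<Delta> j" "measure_pmf.variance (B i) (g i) \<le> 1"
      if "j < K" "i \<in> cell K m r j b" for i j b
      using row_channel_moments[OF p, of "\<rho> / 4" e j "row_mean k e j (\<rho> / 4) q"] \<rho>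
      unfolding B_def g_def \<Delta>_def row_cell[OF that] by auto
    have disj: "j = j' \<and> b = b'"
      if "j < K" "j' < K" "i \<in> cell K m r j b" "i \<in> cell K m r j' b'" for i j b j' b'
      using cell_disjoint[OF that] by simp
    have moments:
      "measure_pmf.expectation (messages n P p) (T r) = (real m)\<^sup>2 * D p"
      "measure_pmf.variance (messages n P p) (T r) \<le> real K * (real m)\<^sup>2 + 2 * real m ^ 3 * D p"
      unfolding M T D_def \<Delta>_def[symmetric]
      by (rule pair_stat_moments[OF finite_atLeastAtMost cell[OF _ r] card_cell[OF m] disj g];
          assumption)+
    have int: "integrable (messages n P p) f" for f :: "_ \<Rightarrow> real"
      unfolding M by (intro integrable_measure_pmf_finite finite_set_Pi_pmf) auto
    have "K \<ge> 1" "real m * D0 \<ge> 160 * sqrt K"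
      using D0(2) by (auto simp: K_def)
    note test = threshold_test_error[OF int int moments this(1) D0_pos this(2)]
    show "D p = 0 \<Longrightarrow> measure_pmf.prob (messages n P p) {y. T r y > \<tau>} \<le> 1 / 16"
      "D p \<ge> D0 \<Longrightarrow> measure_pmf.prob (messages n P p) {y. T r y \<le> \<tau>} \<le> 1 / 16"
      unfolding \<tau>_def by (fact test)+
  qed
  show "pmf (verdict n P q) True > 1 - (1 / 2) ^ R"
  proof -
    have "measure_pmf.prob (messages n P q) {y. R \<le> 2 * card {r. r < R \<and> T r y > \<tau>}} < (1 / 2) ^ R"
      using err(1)[OF q] by (intro majority[where Q = "\<lambda>t. t > \<tau>"]) (auto simp: D_def)
    moreover have "measure_pmf.prob (messages n P q) {y. \<not> 2 * card {r. r < R \<and> T r y > \<tau>} \<le> R} \<le>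
        measure_pmf.prob (messages n P q) {y. R \<le> 2 * card {r. r < R \<and> T r y > \<tau>}}"
      by (intro measure_pmf.finite_measure_mono) auto
    ultimately show ?thesis
      unfolding P pmf_verdict_testing_protocol(1) unfolding T_def \<tau>_def P by linarith
  qed
  show "pmf (verdict n P p) False > 1 - (1 / 2) ^ R"
    if p: "distribution_on k p" and tv: "tv_dist k p q > \<epsilon>"
  proof -
    have "D p \<ge> D0"
      using row_mean_separation[OF k tv \<epsilon>, of "\<rho> / 4"]
      by (simp add: D_def K_def D0(1) power_divide)
    then have "measure_pmf.prob (messages n P p) {y. R \<le> 2 * card {r. r < R \<and> T r y \<le> \<tau>}} < (1 / 2) ^ R"
      using err(2)[OF p] by (intro majority[where Q = "\<lambda>t. t \<le> \<tau>"]) auto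
    moreover have "measure_pmf.prob (messages n P p) {y. 2 * card {r. r < R \<and> T r y > \<tau>} \<le> R} \<le>
        measure_pmf.prob (messages n P p) {y. R \<le> 2 * card {r. r < R \<and> T r y \<le> \<tau>}}"
    proof (intro measure_pmf.finite_measure_mono subsetI CollectI)
      fix y assume "y \<in> {y. 2 * card {r. r < R \<and> T r y > \<tau>} \<le> R}"
      \<comment> \<open>Each round lies above \<open>\<tau>\<close> or not, so acceptance means that
        at least half of the rounds err. Ties occur here, which is why
        \<open>majority_failure_bound\<close> counts them as failures.\<close>
      moreover have "card {r. r < R \<and> T r y > \<tau>} + card {r. r < R \<and> T r y \<le> \<tau>} = card {..<R}"
      proof (subst card_Un_disjoint[symmetric])
        show "card ({r. r < R \<and> T r y > \<tau>} \<union> {r. r < R \<and> T r y \<le> \<tau>}) = card {..<R}"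
          by (rule arg_cong[where f = card]) auto
      qed auto
      ultimately show "R \<le> 2 * card {r. r < R \<and> T r y \<le> \<tau>}" by simp
    qed simp
    ultimately show ?thesis
      unfolding P pmf_verdict_testing_protocol(2) unfolding T_def \<tau>_def P by linarith
  qed
qed

lemma testing_protocol_LDP:
  assumes "0 < \<rho>" "\<rho> \<le> 1"
  shows "LDP_protocol n k \<rho> (testing_protocol k' e m R (\<rho> / 4) \<tau> q)"
  unfolding LDP_protocol_def testing_protocol_def by (simp add: row_channel_LDP[OF assms])

section \<open>Choice of parameters and number of players\<close>

lemma coin_flip_protocol:
  assumes "\<delta> > 1 / 2" "\<rho> > 0"
  shows "\<exists>P :: (nat, bool) protocol. LDP_protocol n k \<rho> P \<and> solves_identity_testing n P k \<epsilon> \<delta> q"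
proof (intro exI conjI)
  let ?P = "\<lparr>coin = (\<lambda>_. return_pmf 0), channel = (\<lambda>_ _ _. return_pmf True),
              referee = (\<lambda>_. bernoulli_pmf (1 / 2))\<rparr> :: (nat, bool) protocol"
  show "LDP_protocol n k \<rho> ?P"
    using assms by (auto simp: LDP_protocol_def LDP_def indicator_def)
  \<comment> \<open>Both verdicts have probability \<open>1 / 2 > 1 - \<delta>\<close>, whatever
    \<open>p\<close> is.\<close>
  show "solves_identity_testing n ?P k \<epsilon> \<delta> q"
    using assms by (simp add: solves_identity_testing_def verdict_def)
qed

lemma ex_power_of_two_ge:
  assumes "k \<ge> (1::nat)"
  shows "\<exists>e. k \<le> 2 ^ e \<and> 2 ^ e \<le> 2 * k"
  using assms
proof (induction k rule: dec_induct)
  case base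
  show ?case by (rule exI[of _ 0]) simp
next
  case (step k)
  then obtain e where e: "k \<le> 2 ^ e" "2 ^ e \<le> 2 * k" by auto
  show ?case
  proof (cases "k = 2 ^ e")
    case True
    then show ?thesis using step.hyps by (intro exI[of _ "Suc e"]) auto
  next
    case False
    then show ?thesis using e by (intro exI[of _ e]) auto
  qed
qed

text \<open>Here \<open>s\<close> stands for \<open>\<epsilon>\<^sup>2 * \<rho>\<^sup>2\<close>, so
  \<open>s / 4\<close> is the separation \<open>D0\<close> and \<open>640 = 4 * 160\<close>. The
  remaining work is to absorb the roundings of \<open>m\<close>, \<open>R\<close> and
  \<open>K\<close> into the constant.\<close>

lemma player_budget:
  fixes k K :: nat and s \<delta> :: real
  assumes k: "1 \<le> K" "K \<le> 2 * k" and s: "0 < s" "s \<le> 1" and \<delta>: "0 < \<delta>" "\<delta> \<le> 1 / 2"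
  defines "m \<equiv> nat \<lceil>640 * sqrt K / s\<rceil>" and "R \<equiv> nat \<lceil>log 2 (1 / \<delta>)\<rceil>"
  shows "real m * s / 4 \<ge> 160 * sqrt K" "R \<ge> 1" "(1 / 2) ^ R \<le> \<delta>"
    and "2 * m * K * R \<le> nat \<lceil>21000 * (real k powr (3 / 2) / s) * ln (1 / \<delta>)\<rceil>"
proof -
  let ?l = "log 2 (1 / \<delta>)"
  have sK: "sqrt K \<ge> 1" using k by simp
  have l: "?l \<ge> 1" using \<delta> by (subst le_log_iff) (auto simp: field_simps)
  have m_ge: "real m \<ge> 640 * sqrt K / s" unfolding m_def by (rule of_nat_ceiling)
  then show "real m * s / 4 \<ge> 160 * sqrt K" using s by (simp add: field_simps)
  have R_ge: "real R \<ge> ?l" unfolding R_def by (rule of_nat_ceiling)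
  then show "R \<ge> 1" using l by linarith
  have "1 / \<delta> = 2 powr ?l" using \<delta> by simp
  also have "\<dots> \<le> 2 powr real R" using R_ge by (intro powr_mono) auto
  finally have "1 / \<delta> \<le> 2 ^ R" by (simp add: powr_realpow)
  then show "(1 / 2) ^ R \<le> \<delta>" using \<delta> by (simp add: power_divide field_simps)
  \<comment> \<open>The ceiling adds less than \<open>1\<close>, so \<open>640\<close> becomes
    \<open>641\<close>.\<close>
  have "1 \<le> sqrt K / s" using order.trans[OF s(2) sK] s(1) by simp
  then have m_le: "real m \<le> 641 * (sqrt K / s)"
    unfolding m_def by linarith
  \<comment> \<open>As \<open>\<delta> \<le> 1 / 2\<close>, the logarithm is at least
    \<open>1\<close> and rounding up at most doubles it.\<close>
  have "real R \<le> 2 * ?l" unfolding R_def using l by linarith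
  also have "\<dots> \<le> 4 * ln (1 / \<delta>)"
    using ln2_ge_two_thirds l by (simp add: log_def field_simps)
  finally have R_le: "real R \<le> 4 * ln (1 / \<delta>)" .
  have "real K * sqrt K \<le> (2 * real k) * (2 * sqrt k)"
  proof (intro mult_mono)
    \<comment> \<open>\<open>K \<le> 2 * k\<close> is relaxed to \<open>4 * k\<close> to obtain an
      integer factor after taking the root.\<close>
    have "sqrt K \<le> sqrt (4 * real k)" using k by (intro real_sqrt_le_mono) linarith
    then show "sqrt K \<le> 2 * sqrt k" by (simp add: real_sqrt_mult)
  qed (use k in auto)
  also have "real k * sqrt k = real k powr (3 / 2)"
    using k powr_add[of "real k" 1 "1 / 2"] by (simp add: powr_half_sqrt)
  then have "(2 * real k) * (2 * sqrt k) = 4 * real k powr (3 / 2)" by simp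
  finally have K_le: "real K * sqrt K \<le> 4 * real k powr (3 / 2)" .
  have "real (2 * m * K * R) = 2 * real K * (real m * real R)" by simp
  also have "\<dots> \<le> 2 * real K * (641 * (sqrt K / s) * (4 * ln (1 / \<delta>)))"
    using s by (intro mult_left_mono mult_mono m_le R_le) auto
  also have "\<dots> = (real K * sqrt K) * (5128 * ln (1 / \<delta>) / s)" by simp
  also have "\<dots> \<le> (4 * real k powr (3 / 2)) * (5128 * ln (1 / \<delta>) / s)"
    using s \<delta> by (intro mult_right_mono K_le) auto
  also have "\<dots> = 20512 * (real k powr (3 / 2) / s * ln (1 / \<delta>))" by simp
  also have "\<dots> \<le> 21000 * (real k powr (3 / 2) / s * ln (1 / \<delta>))"
    using s \<delta> by (intro mult_right_mono mult_nonneg_nonneg divide_nonneg_nonneg) auto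
  finally have "real (2 * m * K * R) \<le> 21000 * (real k powr (3 / 2) / s) * ln (1 / \<delta>)" by simp
  then show "2 * m * K * R \<le> nat \<lceil>21000 * (real k powr (3 / 2) / s) * ln (1 / \<delta>)\<rceil>"
    by linarith
qed

theorem theorem2:
  shows "\<exists>C::real. C > 0 \<and>
    (\<forall>(k::nat) (\<rho>::real) (\<epsilon>::real) (\<delta>::real) (q::nat pmf).
       k \<ge> 1 \<and> \<rho> \<in> {0<..1} \<and> \<epsilon> \<in> {0<..1} \<and> \<delta> \<in> {0<..<1} \<and> distribution_on k q \<longrightarrow>
       (\<exists>(P::(nat, bool) protocol) (n::nat).
          n = nat \<lceil>C * (real k powr (3 / 2) / (\<epsilon>\<^sup>2 * \<rho>\<^sup>2)) * ln (1 / \<delta>)\<rceil> \<and>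
          LDP_protocol n k \<rho> P \<and>
          solves_identity_testing n P k \<epsilon> \<delta> q))"
\<comment> \<open>\<open>21000\<close> rounds up \<open>20512 = 2 * 641 * 4 * 4\<close> from
  \<open>player_budget\<close>.\<close>
proof (intro exI[of _ 21000] conjI allI impI, goal_cases)
  case (2 k \<rho> \<epsilon> \<delta> q)
  then have k: "k \<ge> 1" and \<rho>: "0 < \<rho>" "\<rho> \<le> 1" and \<epsilon>: "0 < \<epsilon>" "\<epsilon> \<le> 1"
    and \<delta>: "0 < \<delta>" "\<delta> < 1" and q: "distribution_on k q" by auto
  define s where "s = \<epsilon>\<^sup>2 * \<rho>\<^sup>2"
  define n where "n = nat \<lceil>21000 * (real k powr (3 / 2) / s) * ln (1 / \<delta>)\<rceil>"
  have "\<exists>P :: (nat, bool) protocol. LDP_protocol n k \<rho> P \<and> solves_identity_testing n P k \<epsilon> \<delta> q"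
  proof (cases "\<delta> > 1 / 2")
    case True
    then show ?thesis using \<rho> by (intro coin_flip_protocol)
  next
    case False
    have s: "0 < s" "s \<le> 1"
      using \<rho> \<epsilon> by (auto simp: s_def power_le_one mult_le_one)
    obtain e where e: "k \<le> 2 ^ e" "2 ^ e \<le> 2 * k"
      using ex_power_of_two_ge[OF k] by auto
    define m where "m = nat \<lceil>640 * sqrt (2 ^ e) / s\<rceil>"
    define R where "R = nat \<lceil>log 2 (1 / \<delta>)\<rceil>"
    have budget: "real m * s / 4 \<ge> 160 * sqrt (2 ^ e)" "R \<ge> 1" "(1 / 2) ^ R \<le> \<delta>"
      "2 * m * 2 ^ e * R \<le> n"
      using player_budget[of "2 ^ e" k s \<delta>] e s \<delta> False by (auto simp: m_def R_def n_def)
    define P where "P = testing_protocol k e m R (\<rho> / 4) ((real m)\<^sup>2 * (s / 4) / 2) q"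
    note correct = testing_protocol_correct[OF e(1) budget(2,4) \<rho> \<epsilon>(1) q, of "s / 4", OF _ _ P_def]
    have "solves_identity_testing n P k \<epsilon> \<delta> q"
      unfolding solves_identity_testing_def
      using correct budget by (fastforce simp: s_def mult.commute)
    moreover have "LDP_protocol n k \<rho> P"
      unfolding P_def by (rule testing_protocol_LDP[OF \<rho>])
    ultimately show ?thesis by blast
  qed
  then show ?case unfolding n_def s_def by blast
qed simp

end
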